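(* Let $H$ be a connected, irregular graph with maximum degree $\Delta\ge2$. Then $H$ is stable (i.e. $1/\Delta+\varepsilon_H>1/m(H)$) if and only if $$\mathcal{J}^*(H)=\{J\subseteq H: e_J/v_J=m(H)\}.$$
   Context: $v_J,e_J$ are the numbers of vertices and edges of $J$; a graph is nonempty if it has at least one edge. $\alpha_J^*$ is the fractional independence number of $J$: the maximum of $\sum_v a_v$ over $a\colon V(J)\to[0,1]$ with $a_u+a_v\le1$ for all $uv\in E(J)$. For an independent set $A\subseteq V(H)$, $N(A)$ is its neighbourhood and $H[A,N(A)]$ is the bipartite graph with parts $A,N(A)$ containing all edges of $H$ between them. $\mathcal{J}(H)=\{H[A,N(A)] : A\ne\varnothing$ an independent set of vertices of degree $\Delta\}$; $r=r_H$ is the maximum of $|A|/|N(A)|$ over all such $A$; $\mathcal{J}^*(H)$ is the set of $H[A,N(A)]\in\mathcal{J}(H)$ achieving this maximum. $m(H)=\max\{e_J/v_J:\varnothing\ne J\subseteq H\}$. $$\varepsilon_H=\min\Big\{\frac{v_J-\alpha_J^*-e_J/\Delta}{e_J-r\Delta\alpha_J^*}:\varnothing\ne J\subseteq H,\ J\notin\mathcal{J}^*(H),\ r\Delta\alpha_J^*<e_J\Big\}\quad(\min\varnothing=\infty).$$ Irregular means not regular. *)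

theory Defs
  imports Complex_Main "HOL-Library.Extended_Real"
begin

text \<open>
  Finite simple graphs are pairs of a vertex set and a set of two-element edges, so that
  subgraphs (which may have isolated vertices) are again values of the same type and can be
  compared for equality.
\<close>

type_synonym 'a graph = "'a set \<times> 'a set set"

abbreviation verts :: "'a graph \<Rightarrow> 'a set" where "verts G \<equiv> fst G"

abbreviation edges :: "'a graph \<Rightarrow> 'a set set" where "edges G \<equiv> snd G"

definition simple_graph :: "'a graph \<Rightarrow> bool" where
  "simple_graph G \<longleftrightarrow> finite (verts G) \<and> (\<forall>e\<in>edges G. e \<subseteq> verts G \<and> card e = 2)"

definition subgraph :: "'a graph \<Rightarrow> 'a graph \<Rightarrow> bool" where
  "subgraph J H \<longleftrightarrow> simple_graph J \<and> verts J \<subseteq> verts H \<and> edges J \<subseteq> edges H"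

definition nonempty_subgraphs :: "'a graph \<Rightarrow> 'a graph set" where
  "nonempty_subgraphs H = {J. subgraph J H \<and> edges J \<noteq> {}}"

definition vcount :: "'a graph \<Rightarrow> real" where
  "vcount J = real (card (verts J))"

definition ecount :: "'a graph \<Rightarrow> real" where
  "ecount J = real (card (edges J))"

definition graph_connected :: "'a graph \<Rightarrow> bool" where
  "graph_connected G \<longleftrightarrow> verts G \<noteq> {} \<and>
     (\<forall>u\<in>verts G. \<forall>v\<in>verts G. (\<lambda>x y. {x, y} \<in> edges G)\<^sup>*\<^sup>* u v)"

definition vertex_degree :: "'a graph \<Rightarrow> 'a \<Rightarrow> nat" where
  "vertex_degree G v = card {e \<in> edges G. v \<in> e}"

definition max_degree :: "'a graph \<Rightarrow> nat" where
  "max_degree G = Max (vertex_degree G ` verts G)"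

definition regular_graph :: "'a graph \<Rightarrow> bool" where
  "regular_graph G \<longleftrightarrow> (\<exists>d. \<forall>v\<in>verts G. vertex_degree G v = d)"

definition neighbourhood :: "'a graph \<Rightarrow> 'a set \<Rightarrow> 'a set" where
  "neighbourhood G A = {v \<in> verts G. \<exists>u\<in>A. {u, v} \<in> edges G}"

definition independent_set :: "'a graph \<Rightarrow> 'a set \<Rightarrow> bool" where
  "independent_set G A \<longleftrightarrow> A \<subseteq> verts G \<and> (\<forall>u\<in>A. \<forall>v\<in>A. {u, v} \<notin> edges G)"

text \<open>
  The set of values over which the supremum is taken is nonempty, bounded by the number of
  vertices, and compact, so on finite graphs the supremum is a maximum.
\<close>

definition frac_indep_number :: "'a graph \<Rightarrow> real" where
  "frac_indep_number J =
     (SUP a \<in> {a :: 'a \<Rightarrow> real. (\<forall>v\<in>verts J. 0 \<le> a v \<and> a v \<le> 1) \<and>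
                 (\<forall>u v. {u, v} \<in> edges J \<longrightarrow> a u + a v \<le> 1)}.
        \<Sum>v\<in>verts J. a v)"

definition bip_subgraph :: "'a graph \<Rightarrow> 'a set \<Rightarrow> 'a set \<Rightarrow> 'a graph" where
  "bip_subgraph H A B = (A \<union> B, {e \<in> edges H. \<exists>u\<in>A. \<exists>v\<in>B. e = {u, v}})"

definition maxdeg_indep_sets :: "'a graph \<Rightarrow> 'a set set" where
  "maxdeg_indep_sets H =
     {A. A \<noteq> {} \<and> independent_set H A \<and> (\<forall>v\<in>A. vertex_degree H v = max_degree H)}"

definition expansion_ratio :: "'a graph \<Rightarrow> 'a set \<Rightarrow> real" where
  "expansion_ratio H A = real (card A) / real (card (neighbourhood H A))"

definition r_ratio :: "'a graph \<Rightarrow> real" where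
  "r_ratio H = Max (expansion_ratio H ` maxdeg_indep_sets H)"

definition J_star :: "'a graph \<Rightarrow> 'a graph set" where
  "J_star H = {bip_subgraph H A (neighbourhood H A) | A.
     A \<in> maxdeg_indep_sets H \<and> expansion_ratio H A = r_ratio H}"

definition max_density :: "'a graph \<Rightarrow> real" where
  "max_density H = Max ((\<lambda>J. ecount J / vcount J) ` nonempty_subgraphs H)"

text \<open>
  A finite graph has finitely many subgraphs, so this infimum is a minimum; over the empty
  set the infimum in the extended reals is infinity, as required.
\<close>

definition eps :: "'a graph \<Rightarrow> ereal" where
  "eps H =
     (INF J \<in> {J \<in> nonempty_subgraphs H. J \<notin> J_star H \<and>
                 r_ratio H * real (max_degree H) * frac_indep_number J < ecount J}.
        ereal ((vcount J - frac_indep_number J - ecount J / real (max_degree H)) /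
               (ecount J - r_ratio H * real (max_degree H) * frac_indep_number J)))"

definition stable_graph :: "'a graph \<Rightarrow> bool" where
  "stable_graph H \<longleftrightarrow> ereal (1 / real (max_degree H)) + eps H > ereal (1 / max_density H)"

end

theory Submission
  imports Defs "HOL-Analysis.Function_Topology"
begin

text \<open>
  Writing \<open>b = 1 - a\<close> for an optimal fractional independent set \<open>a\<close> of \<open>J\<close>, weighted double
  counting of the edges gives \<open>e\<^sub>J \<le> \<Delta> (v\<^sub>J - \<alpha>\<^sub>J)\<close>. In the case of equality \<open>b\<close> lives
  on vertices of full degree in \<open>J\<close>, and \<open>b u + b v = 1\<close> on every edge. Connectedness and
  irregularity of \<open>H\<close> then exclude values strictly between \<open>0\<close> and \<open>1\<close>, so that \<open>b\<close> is the
  indicator of an independent set \<open>A\<close> of vertices of degree \<open>\<Delta>\<close>; if also \<open>e\<^sub>J = r \<Delta> \<alpha>\<^sub>J\<close>,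
  then \<open>J = H[A, N(A)]\<close> is in \<open>J\<^sup>*(H)\<close>. Members of \<open>J\<^sup>*(H)\<close> have density
  \<open>r \<Delta> / (1 + r)\<close>, and for any other \<open>J\<close> comparing the quotient in the definition of
  \<open>\<epsilon>\<close> with \<open>1 / m - 1 / \<Delta>\<close> amounts to comparing \<open>e\<^sub>J / v\<^sub>J\<close> with that density.
\<close>

section \<open>Finiteness, degrees and weighted edge counting\<close>

lemma simple_graph_edgeE:
  assumes "simple_graph G" "e \<in> edges G"
  obtains u v where "e = {u, v}" "u \<noteq> v" "u \<in> verts G" "v \<in> verts G"
  using assms unfolding simple_graph_def by (metis card_2_iff insert_subset)

lemma simple_graph_finite_verts: "simple_graph G \<Longrightarrow> finite (verts G)"
  by (simp add: simple_graph_def)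

lemma simple_graph_finite_edges: "simple_graph G \<Longrightarrow> finite (edges G)"
  unfolding simple_graph_def by (metis PowI finite_Pow_iff finite_subset subsetI)

lemma finite_nonempty_subgraphs:
  assumes "simple_graph H"
  shows "finite (nonempty_subgraphs H)"
proof (rule finite_subset)
  show "nonempty_subgraphs H \<subseteq> Pow (verts H) \<times> Pow (edges H)"
    by (auto simp: nonempty_subgraphs_def subgraph_def)
  show "finite (Pow (verts H) \<times> Pow (edges H))"
    using assms by (simp add: simple_graph_finite_verts simple_graph_finite_edges)
qed

lemma vertex_degree_le_max_degree:
  assumes "simple_graph H" "v \<in> verts H"
  shows "vertex_degree H v \<le> max_degree H"
  using assms unfolding max_degree_def by (simp add: simple_graph_finite_verts)

lemma vertex_degree_subgraph_le:
  assumes "simple_graph H" "subgraph J H"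
  shows "vertex_degree J v \<le> vertex_degree H v"
  unfolding vertex_degree_def using assms
  by (intro card_mono) (auto simp: subgraph_def simple_graph_finite_edges)

text \<open>Degrees in \<open>J\<close> are at most those in \<open>H\<close>, hence at most
  \<Delta>. At a vertex reaching \<Delta> the edges of \<open>J\<close> are a subset of the edges of
  \<open>H\<close> of the same finite size, so none is missing.\<close>

lemma subgraph_max_degree_vertex:
  assumes "simple_graph H" "subgraph J H" "v \<in> verts J" "vertex_degree J v = max_degree H"
  shows "vertex_degree H v = max_degree H"
    and "\<And>e. e \<in> edges H \<Longrightarrow> v \<in> e \<Longrightarrow> e \<in> edges J"
proof -
  have "v \<in> verts H" using assms by (auto simp: subgraph_def)
  then show deg: "vertex_degree H v = max_degree H"
    using vertex_degree_le_max_degree[OF assms(1)] vertex_degree_subgraph_le[OF assms(1,2), of v] assms(4)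
    by fastforce
  have "{e \<in> edges J. v \<in> e} = {e \<in> edges H. v \<in> e}"
  proof (rule card_subset_eq)
    show "finite {e \<in> edges H. v \<in> e}" using assms(1) by (simp add: simple_graph_finite_edges)
    show "{e \<in> edges J. v \<in> e} \<subseteq> {e \<in> edges H. v \<in> e}" using assms(2) by (auto simp: subgraph_def)
    show "card {e \<in> edges J. v \<in> e} = card {e \<in> edges H. v \<in> e}"
      using deg assms(4) by (simp add: vertex_degree_def)
  qed
  then show "\<And>e. e \<in> edges H \<Longrightarrow> v \<in> e \<Longrightarrow> e \<in> edges J" by blast
qed

text \<open>Both sides sum \<open>b v\<close> over the incident pairs \<open>(v, e)\<close>. The
  lemma serves twice: with \<open>1 - a\<close> for the slack identity, and with the indicator of an
  independent set to count edges.\<close>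

lemma weighted_handshake:
  fixes b :: "'a \<Rightarrow> real"
  assumes "simple_graph G"
  shows "(\<Sum>e\<in>edges G. \<Sum>v\<in>e. b v) = (\<Sum>v\<in>verts G. real (vertex_degree G v) * b v)"
proof -
  have "(\<Sum>e\<in>edges G. \<Sum>v\<in>e. b v) = (\<Sum>e\<in>edges G. \<Sum>v\<in>{v \<in> verts G. v \<in> e}. b v)"
    using assms by (intro sum.cong refl) (auto simp: simple_graph_def)
  also have "\<dots> = (\<Sum>v\<in>verts G. \<Sum>e\<in>{e \<in> edges G. v \<in> e}. b v)"
    using assms by (intro sum.swap_restrict simple_graph_finite_verts simple_graph_finite_edges)
  also have "\<dots> = (\<Sum>v\<in>verts G. real (vertex_degree G v) * b v)"
    by (simp add: vertex_degree_def)
  finally show ?thesis .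
qed


subsection \<open>Fractional independent sets\<close>

definition frac_indep :: "'a graph \<Rightarrow> ('a \<Rightarrow> real) \<Rightarrow> bool" where
  "frac_indep J a \<longleftrightarrow> (\<forall>v\<in>verts J. 0 \<le> a v \<and> a v \<le> 1) \<and>
     (\<forall>u v. {u, v} \<in> edges J \<longrightarrow> a u + a v \<le> 1)"

lemma frac_indep_number_alt:
  "frac_indep_number J = (SUP a \<in> {a. frac_indep J a}. \<Sum>v\<in>verts J. a v)"
  by (simp add: frac_indep_number_def frac_indep_def)

lemma frac_indep_sum_le:
  assumes "simple_graph J" "frac_indep J a"
  shows "(\<Sum>v\<in>verts J. a v) \<le> frac_indep_number J"
  unfolding frac_indep_number_alt
proof (rule cSUP_upper)
  show "a \<in> {a. frac_indep J a}" using assms by simp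
  have "(\<Sum>v\<in>verts J. a' v) \<le> real (card (verts J)) * 1" if "frac_indep J a'" for a'
    using that unfolding frac_indep_def by (intro sum_bounded_above) auto
  then show "bdd_above ((\<lambda>a. \<Sum>v\<in>verts J. a v) ` {a. frac_indep J a})"
    by (intro bdd_aboveI[where M = "real (card (verts J))"]) auto
qed

text \<open>A compactness argument. Feasible weightings are unconstrained off
  \<open>verts J\<close>, so the maximum is taken over those that vanish there; this leaves the
  attainable sums unchanged.\<close>

lemma frac_indep_number_attained:
  assumes J: "simple_graph J"
  obtains a where "frac_indep J a" "(\<Sum>v\<in>verts J. a v) = frac_indep_number J"
proof -
  \<comment> \<open>Every factor is compact, being \<open>{0..1}\<close> or \<open>{0}\<close>, so
    Tychonoff applies even when the vertex type is infinite. The edge constraints then cut out a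
    closed subset.\<close>
  define P where "P = (\<Pi>\<^sub>E v\<in>(UNIV :: 'a set). if v \<in> verts J then {0..1::real} else {0})"
  define C where "C = {a :: 'a \<Rightarrow> real. \<forall>u v. {u, v} \<in> edges J \<longrightarrow> a u + a v \<le> 1}"
  have cont: "continuous_on UNIV (\<lambda>a :: 'a \<Rightarrow> real. a v)" for v
    by simp
  have "compactin (product_topology (\<lambda>_. euclidean) UNIV) P"
    unfolding P_def compactin_PiE by auto
  then have "compact P"
    by (simp add: euclidean_product_topology)
  moreover have "closed C"
    unfolding C_def
    by (intro closed_Collect_all closed_Collect_imp open_Collect_const closed_Collect_le
        continuous_on_add cont continuous_on_const)
  ultimately have "compact (P \<inter> C)" by (rule compact_Int_closed)
  moreover have "(\<lambda>_. 0) \<in> P \<inter> C" by (auto simp: P_def C_def PiE_UNIV_domain)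
  moreover have "continuous_on (P \<inter> C) (\<lambda>a. \<Sum>v\<in>verts J. a v)"
    by (intro continuous_on_sum continuous_on_subset[OF cont subset_UNIV])
  ultimately obtain a where a: "a \<in> P \<inter> C"
    and max: "\<And>a'. a' \<in> P \<inter> C \<Longrightarrow> (\<Sum>v\<in>verts J. a' v) \<le> (\<Sum>v\<in>verts J. a v)"
    using continuous_attains_sup[of "P \<inter> C" "\<lambda>a. \<Sum>v\<in>verts J. a v"]
    by (metis empty_iff)
  have fa: "frac_indep J a"
    using a unfolding frac_indep_def P_def C_def PiE_UNIV_domain Pi_iff
    by (auto dest!: spec split: if_splits)
  have "frac_indep_number J \<le> (\<Sum>v\<in>verts J. a v)"
    unfolding frac_indep_number_alt
  proof (rule cSUP_least)
    show "{a. frac_indep J a} \<noteq> {}" using fa by auto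
    fix a' assume "a' \<in> {a. frac_indep J a}"
    then have a': "frac_indep J a'" by simp
    \<comment> \<open>Truncating to zero off \<open>verts J\<close> keeps the sum, and keeps the
      edge constraints because the ends of edges of \<open>J\<close> lie in
      \<open>verts J\<close>.\<close>
    define c where "c = (\<lambda>v. if v \<in> verts J then a' v else 0)"
    have "c u + c v \<le> 1" if "{u, v} \<in> edges J" for u v
    proof -
      have "u \<in> verts J" "v \<in> verts J" using J that by (auto simp: simple_graph_def)
      then show ?thesis using a' that by (simp add: c_def frac_indep_def)
    qed
    then have "c \<in> P \<inter> C"
      using a' by (auto simp: P_def C_def c_def frac_indep_def PiE_UNIV_domain)
    from max[OF this] show "(\<Sum>v\<in>verts J. a' v) \<le> (\<Sum>v\<in>verts J. a v)"
      by (simp add: c_def)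
  qed
  with frac_indep_sum_le[OF J fa] fa that show thesis by force
qed

text \<open>The constant weighting 1/2 is feasible. Positivity allows a factor \<alpha> to be
  cancelled in \<open>density_quotient_less_iff\<close>.\<close>

lemma frac_indep_number_pos:
  assumes "simple_graph J" "edges J \<noteq> {}"
  shows "0 < frac_indep_number J"
proof -
  obtain v where "v \<in> verts J" using assms by (metis all_not_in_conv simple_graph_edgeE)
  then have "0 < card (verts J)" using assms(1) by (auto simp: card_gt_0_iff simple_graph_finite_verts)
  moreover have "frac_indep J (\<lambda>_. 1/2)" by (simp add: frac_indep_def)
  ultimately show ?thesis using frac_indep_sum_le[OF assms(1)] by force
qed

text \<open>The weighted handshake for \<open>1 - a\<close> splits the slack exactly into a degree
  deficit at each vertex and an excess on each edge. Nonnegativity of the terms yields the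
  inequality, and their vanishing yields the equality case.\<close>

lemma frac_indep_slack:
  assumes "simple_graph J" "0 < d"
  shows "d * (vcount J - (\<Sum>v\<in>verts J. a v) - ecount J / d) =
    (\<Sum>v\<in>verts J. (d - real (vertex_degree J v)) * (1 - a v)) +
    (\<Sum>e\<in>edges J. (\<Sum>v\<in>e. 1 - a v) - 1)"
  using weighted_handshake[OF assms(1), of "\<lambda>v. 1 - a v"] assms(2)
  by (simp add: vcount_def ecount_def sum_subtractf left_diff_distrib right_diff_distrib
      sum_distrib_left)

lemma frac_indep_slack_nonneg:
  assumes "simple_graph H" "subgraph J H" "frac_indep J a"
  shows "v \<in> verts J \<Longrightarrow> 0 \<le> (real (max_degree H) - real (vertex_degree J v)) * (1 - a v)"
    and "e \<in> edges J \<Longrightarrow> 0 \<le> (\<Sum>v\<in>e. 1 - a v) - 1"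
proof -
  assume v: "v \<in> verts J"
  then have "vertex_degree J v \<le> max_degree H"
    using vertex_degree_le_max_degree[OF assms(1)] vertex_degree_subgraph_le[OF assms(1,2), of v] assms(2)
    by (meson le_trans subgraph_def subsetD)
  then show "0 \<le> (real (max_degree H) - real (vertex_degree J v)) * (1 - a v)"
    using assms(3) v by (simp add: frac_indep_def)
next
  assume "e \<in> edges J"
  moreover obtain u v where "e = {u, v}" "u \<noteq> v"
    using simple_graph_edgeE calculation assms(2) unfolding subgraph_def by metis
  moreover from calculation have "a u + a v \<le> 1" using assms(3) by (simp add: frac_indep_def)
  ultimately show "0 \<le> (\<Sum>v\<in>e. 1 - a v) - 1" by simp
qed

text \<open>The slack identity is applied to an optimal \<open>a\<close>. Since \<open>1 - a\<close>
  is a fractional vertex cover, \<open>vcount J - frac_indep_number J\<close> is the fractional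
  cover number.\<close>

lemma ecount_le_frac_cover:
  assumes "simple_graph H" "subgraph J H" "0 < max_degree H"
  shows "0 \<le> vcount J - frac_indep_number J - ecount J / real (max_degree H)"
proof -
  have J: "simple_graph J" using assms by (simp add: subgraph_def)
  obtain a where a: "frac_indep J a" "(\<Sum>v\<in>verts J. a v) = frac_indep_number J"
    using frac_indep_number_attained[OF J] .
  have "0 \<le> real (max_degree H) * (vcount J - (\<Sum>v\<in>verts J. a v) - ecount J / real (max_degree H))"
    using frac_indep_slack[OF J, of "real (max_degree H)" a] assms(3)
      frac_indep_slack_nonneg[OF assms(1,2) a(1)]
    by (simp add: sum_nonneg add_nonneg_nonneg)
  then show ?thesis using a(2) assms(3) by (simp add: zero_le_mult_iff)
qed

text \<open>Complementary slackness: the nonnegative terms of the slack identity sum to zero, so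
  each of them is zero.\<close>

lemma frac_cover_tight:
  assumes "simple_graph H" "subgraph J H" "0 < max_degree H" "frac_indep J a"
    and "vcount J - (\<Sum>v\<in>verts J. a v) = ecount J / real (max_degree H)"
  shows "v \<in> verts J \<Longrightarrow> a v \<noteq> 1 \<Longrightarrow> vertex_degree J v = max_degree H"
    and "{u, v} \<in> edges J \<Longrightarrow> a u + a v = 1"
proof -
  have J: "simple_graph J" using assms by (simp add: subgraph_def)
  note nn = frac_indep_slack_nonneg[OF assms(1,2,4)]
  define S where "S = (\<Sum>v\<in>verts J. (real (max_degree H) - real (vertex_degree J v)) * (1 - a v))"
  define T where "T = (\<Sum>e\<in>edges J. (\<Sum>v\<in>e. 1 - a v) - 1)"
  have "S + T = 0"
    using frac_indep_slack[OF J, of "real (max_degree H)" a] assms(3,5) by (simp add: S_def T_def)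
  moreover have "0 \<le> S" "0 \<le> T" using nn by (auto simp: S_def T_def intro!: sum_nonneg)
  ultimately have "S = 0" "T = 0" by auto
  then have zero: "\<forall>v\<in>verts J. (real (max_degree H) - real (vertex_degree J v)) * (1 - a v) = 0"
      "\<forall>e\<in>edges J. (\<Sum>v\<in>e. 1 - a v) - 1 = 0"
    unfolding S_def T_def
    using nn J by (simp_all add: sum_nonneg_eq_0_iff simple_graph_finite_verts simple_graph_finite_edges)
  show "vertex_degree J v = max_degree H" if "v \<in> verts J" "a v \<noteq> 1"
    using zero(1) that by auto
  show "a u + a v = 1" if e: "{u, v} \<in> edges J"
  proof -
    have "u \<noteq> v" using J e by (auto simp: simple_graph_def)
    then show ?thesis using zero(2) e by fastforce
  qed
qed


subsection \<open>Subgraphs spanned by independent sets of maximum degree\<close>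

lemma bip_subgraph_edges:
  assumes "simple_graph H"
  shows "edges (bip_subgraph H A (neighbourhood H A)) = {e \<in> edges H. e \<inter> A \<noteq> {}}"
proof (intro set_eqI iffI)
  fix e assume "e \<in> {e \<in> edges H. e \<inter> A \<noteq> {}}"
  then obtain x where e: "e \<in> edges H" "x \<in> e" "x \<in> A" by auto
  obtain u v where "e = {u, v}" "u \<in> verts H" "v \<in> verts H"
    using simple_graph_edgeE[OF assms e(1)] .
  with e obtain y where "e = {x, y}" "y \<in> verts H" by blast
  then show "e \<in> edges (bip_subgraph H A (neighbourhood H A))"
    using e unfolding bip_subgraph_def neighbourhood_def by auto
qed (auto simp: bip_subgraph_def)

lemma independent_set_disjoint_neighbourhood:
  assumes "independent_set H A"
  shows "A \<inter> neighbourhood H A = {}"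
  using assms unfolding independent_set_def neighbourhood_def by blast

lemma subgraph_bip_subgraph:
  assumes "simple_graph H" "A \<subseteq> verts H"
  shows "subgraph (bip_subgraph H A (neighbourhood H A)) H"
proof -
  have "neighbourhood H A \<subseteq> verts H" by (auto simp: neighbourhood_def)
  moreover have "finite (A \<union> neighbourhood H A)"
    using assms calculation by (meson finite_subset le_sup_iff simple_graph_finite_verts)
  ultimately show ?thesis
    using assms unfolding subgraph_def simple_graph_def bip_subgraph_def by auto
qed

text \<open>Independence makes \<open>A\<close> disjoint from its neighbourhood, so each edge has
  exactly one end in \<open>A\<close>. All edges of \<open>H\<close> at \<open>A\<close> are kept,
  so the handshake for the indicator of \<open>A\<close> counts \<Delta> edges per vertex of
  \<open>A\<close>.\<close>

lemma bip_subgraph_counts: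
  assumes H: "simple_graph H" and A: "A \<in> maxdeg_indep_sets H"
  defines "J \<equiv> bip_subgraph H A (neighbourhood H A)"
  shows "vcount J = real (card A) + real (card (neighbourhood H A))"
    and "ecount J = real (max_degree H) * real (card A)"
proof -
  have ind: "independent_set H A" and AV: "A \<subseteq> verts H"
    using A by (auto simp: maxdeg_indep_sets_def independent_set_def)
  have sub: "subgraph J H" unfolding J_def by (rule subgraph_bip_subgraph[OF H AV])
  then have J: "simple_graph J" by (simp add: subgraph_def)
  have VJ: "verts J = A \<union> neighbourhood H A" by (simp add: J_def bip_subgraph_def)
  have fin: "finite A" "finite (neighbourhood H A)"
    using simple_graph_finite_verts[OF J] VJ by auto
  show "vcount J = real (card A) + real (card (neighbourhood H A))"
    using fin independent_set_disjoint_neighbourhood[OF ind]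
    by (simp add: vcount_def VJ card_Un_disjoint)
  have "(\<Sum>v\<in>e. if v \<in> A then 1 else 0) = (1::real)" if e: "e \<in> edges J" for e
  proof -
    obtain u v where uv: "u \<in> A" "v \<in> neighbourhood H A" "e = {u, v}"
      using e by (auto simp: J_def bip_subgraph_def)
    then have "v \<notin> A" using independent_set_disjoint_neighbourhood[OF ind] by auto
    with uv show ?thesis by (auto simp: sum.insert_if)
  qed
  then have "ecount J = (\<Sum>e\<in>edges J. \<Sum>v\<in>e. if v \<in> A then 1 else 0)"
    by (simp add: ecount_def)
  also have "\<dots> = (\<Sum>v\<in>verts J. real (vertex_degree J v) * (if v \<in> A then 1 else 0))"
    by (rule weighted_handshake[OF J])
  also have "\<dots> = (\<Sum>v\<in>verts J. if v \<in> A then real (max_degree H) else 0)"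
  proof (rule sum.cong)
    fix v assume "v \<in> verts J"
    have "vertex_degree J v = max_degree H" if "v \<in> A"
    proof -
      have "{e \<in> edges J. v \<in> e} = {e \<in> edges H. v \<in> e}"
        using that by (auto simp: J_def bip_subgraph_edges[OF H])
      then show ?thesis using A that by (simp add: vertex_degree_def maxdeg_indep_sets_def)
    qed
    then show "real (vertex_degree J v) * (if v \<in> A then 1 else 0)
        = (if v \<in> A then real (max_degree H) else 0)" by simp
  qed simp
  also have "\<dots> = real (max_degree H) * real (card A)"
    using fin by (simp add: VJ sum.If_cases Int_absorb1 Int_commute)
  finally show "ecount J = real (max_degree H) * real (card A)" .
qed

section \<open>The maximal ratio r and the family \<open>J_star\<close>\<close>

lemma finite_maxdeg_indep_sets: "simple_graph H \<Longrightarrow> finite (maxdeg_indep_sets H)"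
  by (rule finite_subset[of _ "Pow (verts H)"])
    (auto simp: maxdeg_indep_sets_def independent_set_def simple_graph_finite_verts)

lemma maxdeg_indep_sets_nonempty:
  assumes H: "simple_graph H" and "verts H \<noteq> {}"
  shows "maxdeg_indep_sets H \<noteq> {}"
proof -
  have "max_degree H \<in> vertex_degree H ` verts H"
    unfolding max_degree_def using assms by (intro Max_in) (auto simp: simple_graph_finite_verts)
  then obtain v where v: "v \<in> verts H" "vertex_degree H v = max_degree H" by auto
  have "{v, v} \<notin> edges H" using H unfolding simple_graph_def by force
  with v have "{v} \<in> maxdeg_indep_sets H" by (simp add: maxdeg_indep_sets_def independent_set_def)
  then show ?thesis by auto
qed

text \<open>The \<Delta>|A| > 0 edges at \<open>A\<close> need other ends, so the denominator of
  \<open>expansion_ratio\<close> is never zero.\<close>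

lemma maxdeg_indep_set_cards_pos:
  assumes H: "simple_graph H" and A: "A \<in> maxdeg_indep_sets H" and "0 < max_degree H"
  shows "0 < card A" "0 < card (neighbourhood H A)"
proof -
  have AV: "A \<subseteq> verts H" using A by (auto simp: maxdeg_indep_sets_def independent_set_def)
  then have fin: "finite A" using H by (meson finite_subset simple_graph_finite_verts)
  then show A0: "0 < card A" using A by (auto simp: maxdeg_indep_sets_def card_gt_0_iff)
  have "edges (bip_subgraph H A (neighbourhood H A)) \<noteq> {}"
    using bip_subgraph_counts(2)[OF H A] A0 assms(3) by (auto simp: ecount_def)
  then have "neighbourhood H A \<noteq> {}" by (auto simp: bip_subgraph_def)
  moreover have "finite (neighbourhood H A)"
    using H by (simp add: neighbourhood_def simple_graph_finite_verts)
  ultimately show "0 < card (neighbourhood H A)" by (simp add: card_gt_0_iff)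
qed

lemma expansion_ratio_le_r_ratio:
  assumes "simple_graph H" "A \<in> maxdeg_indep_sets H"
  shows "expansion_ratio H A \<le> r_ratio H"
  unfolding r_ratio_def using assms by (simp add: finite_maxdeg_indep_sets)

lemma r_ratio_pos:
  assumes "simple_graph H" "verts H \<noteq> {}" "0 < max_degree H"
  shows "0 < r_ratio H"
proof -
  obtain A where "A \<in> maxdeg_indep_sets H" using maxdeg_indep_sets_nonempty[OF assms(1,2)] by auto
  then have "0 < expansion_ratio H A" "expansion_ratio H A \<le> r_ratio H"
    using maxdeg_indep_set_cards_pos[OF assms(1) _ assms(3)] expansion_ratio_le_r_ratio[OF assms(1)]
    by (simp_all add: expansion_ratio_def)
  then show ?thesis by simp
qed

lemma J_star_nonempty:
  assumes "simple_graph H" "verts H \<noteq> {}"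
  shows "J_star H \<noteq> {}"
proof -
  have "r_ratio H \<in> expansion_ratio H ` maxdeg_indep_sets H"
    unfolding r_ratio_def using assms
    by (intro Max_in) (auto simp: finite_maxdeg_indep_sets maxdeg_indep_sets_nonempty)
  then obtain A where "A \<in> maxdeg_indep_sets H" "expansion_ratio H A = r_ratio H" by auto
  then have "bip_subgraph H A (neighbourhood H A) \<in> J_star H" unfolding J_star_def by blast
  then show ?thesis by blast
qed

text \<open>With k = |N(A)| and |A| = rk there are \<Delta>rk edges on (1 + r)k vertices, so all
  members share one density.\<close>

lemma J_star_subgraph:
  assumes H: "simple_graph H" and d: "0 < max_degree H" and J: "J \<in> J_star H"
  shows "J \<in> nonempty_subgraphs H"
    and "ecount J / vcount J = r_ratio H * real (max_degree H) / (1 + r_ratio H)"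
proof -
  obtain A where A: "A \<in> maxdeg_indep_sets H" "expansion_ratio H A = r_ratio H"
    and JA: "J = bip_subgraph H A (neighbourhood H A)"
    using J by (auto simp: J_star_def)
  note counts = bip_subgraph_counts[OF H A(1), folded JA]
  note pos = maxdeg_indep_set_cards_pos[OF H A(1) d]
  have "subgraph J H"
    unfolding JA using A(1)
    by (intro subgraph_bip_subgraph[OF H]) (auto simp: maxdeg_indep_sets_def independent_set_def)
  moreover have "edges J \<noteq> {}" using counts(2) pos d by (auto simp: ecount_def)
  ultimately show "J \<in> nonempty_subgraphs H" by (simp add: nonempty_subgraphs_def)
  show "ecount J / vcount J = r_ratio H * real (max_degree H) / (1 + r_ratio H)"
    unfolding counts A(2)[symmetric] expansion_ratio_def using pos
    by (simp add: field_simps)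
qed

text \<open>The two equalities do separate work: \<open>cover\<close> shows that the edges of
  \<open>J\<close> are those of H[A, N(A)], while \<open>ratio\<close> rules out additional isolated
  vertices and makes \<open>A\<close> attain r.\<close>

lemma tight_subgraph_in_J_star:
  assumes H: "simple_graph H" and conn: "graph_connected H" and irr: "\<not> regular_graph H"
    and d: "0 < max_degree H" and J: "J \<in> nonempty_subgraphs H"
    and cover: "vcount J - frac_indep_number J = ecount J / real (max_degree H)"
    and ratio: "ecount J = r_ratio H * real (max_degree H) * frac_indep_number J"
  shows "J \<in> J_star H"
proof -
  have sub: "subgraph J H" and JS: "simple_graph J" and ne: "edges J \<noteq> {}"
    using J by (auto simp: nonempty_subgraphs_def subgraph_def)
  obtain a where a: "frac_indep J a" "(\<Sum>v\<in>verts J. a v) = frac_indep_number J"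
    using frac_indep_number_attained[OF JS] .
  note tight = frac_cover_tight[OF H sub d a(1) cover[folded a(2)]]
  have full: "vertex_degree H v = max_degree H" "\<And>e. e \<in> edges H \<Longrightarrow> v \<in> e \<Longrightarrow> e \<in> edges J"
    if "v \<in> verts J" "a v \<noteq> 1" for v
    using subgraph_max_degree_vertex[OF H sub that(1) tight(1)[OF that]] by auto
  have a01: "a v = 0 \<or> a v = 1" if v: "v \<in> verts J" for v
  proof (rule ccontr)
    assume nv: "\<not> (a v = 0 \<or> a v = 1)"
    \<comment> \<open>A value other than 0 and 1 spreads along walks of \<open>H\<close>: such a
      vertex has full degree in \<open>J\<close>, so the next edge lies in \<open>J\<close>, and the
      two values on it sum to 1. By connectedness all of \<open>H\<close> would have degree
      \<Delta>.\<close>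
    have step: "w \<in> verts J \<and> a w \<noteq> 0 \<and> a w \<noteq> 1"
      if "(\<lambda>x y. {x, y} \<in> edges H)\<^sup>*\<^sup>* v w" for w
      using that
    proof induction
      case base
      show ?case using v nv by simp
    next
      case (step y z)
      then have e: "{y, z} \<in> edges J" using full(2)[of y "{y, z}"] by simp
      then have "z \<in> verts J" using JS by (auto simp: simple_graph_def)
      moreover have "a y + a z = 1" using tight(2)[OF e] .
      ultimately show ?case using step.IH by auto
    qed
    have "v \<in> verts H" using v sub by (auto simp: subgraph_def)
    then have "\<forall>w\<in>verts H. vertex_degree H w = max_degree H"
      using conn step full(1) unfolding graph_connected_def by blast
    then show False using irr by (auto simp: regular_graph_def)
  qed
  define A where "A = {v \<in> verts J. a v = 0}"
  have AJ: "A \<subseteq> verts J" by (auto simp: A_def)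
  have fullA: "vertex_degree H v = max_degree H" "\<And>e. e \<in> edges H \<Longrightarrow> v \<in> e \<Longrightarrow> e \<in> edges J"
    if "v \<in> A" for v
    using full[of v] that by (auto simp: A_def)
  have nbr: "a v = 1 \<and> v \<in> verts J" if "u \<in> A" "{u, v} \<in> edges H" for u v
  proof -
    have e: "{u, v} \<in> edges J" using fullA(2)[OF that(1,2)] by simp
    then have "v \<in> verts J" using JS by (auto simp: simple_graph_def)
    with tight(2)[OF e] that(1) show ?thesis by (simp add: A_def)
  qed
  have edges_meet: "e \<inter> A \<noteq> {}" if e: "e \<in> edges J" for e
  proof -
    obtain u v where uv: "e = {u, v}" "u \<in> verts J" "v \<in> verts J"
      using simple_graph_edgeE[OF JS e] .
    then show ?thesis using tight(2)[of u v] e a01[of u] a01[of v] by (auto simp: A_def)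
  qed
  have "A \<noteq> {}" using ne edges_meet by auto
  moreover have "independent_set H A"
    unfolding independent_set_def
  proof (intro conjI ballI notI)
    show "A \<subseteq> verts H" using AJ sub by (auto simp: subgraph_def)
    fix u v assume "u \<in> A" "v \<in> A" "{u, v} \<in> edges H"
    then have "a v = 1" "a v = 0" using nbr[of u v] by (simp_all add: A_def)
    then show False by simp
  qed
  ultimately have A: "A \<in> maxdeg_indep_sets H"
    using fullA(1) by (simp add: maxdeg_indep_sets_def)
  have EJ: "edges J = edges (bip_subgraph H A (neighbourhood H A))"
    unfolding bip_subgraph_edges[OF H]
    using edges_meet fullA(2) sub by (auto simp: subgraph_def)
  then have eJ: "ecount J = real (max_degree H) * real (card A)"
    using bip_subgraph_counts(2)[OF H A] by (simp add: ecount_def)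
  have NJ: "neighbourhood H A \<subseteq> verts J - A"
  proof
    fix v assume "v \<in> neighbourhood H A"
    then obtain u where "u \<in> A" "{u, v} \<in> edges H" unfolding neighbourhood_def by blast
    from nbr[OF this] show "v \<in> verts J - A" by (simp add: A_def)
  qed
  have fin: "finite (verts J)" by (rule simple_graph_finite_verts[OF JS])
  note pos = maxdeg_indep_set_cards_pos[OF H A d]
  \<comment> \<open>Now \<alpha> = |V(J) - A|, so \<open>ratio\<close> reads |A| = r |V(J) - A|.
    Maximality of r gives |A| \<le> r |N(A)|, which forces the inclusion of N(A) in V(J) - A to be
    an equality.\<close>
  have "frac_indep_number J = vcount J - real (card A)"
    using cover d by (simp add: eJ)
  also have "\<dots> = real (card (verts J - A))"
    using AJ fin by (simp add: vcount_def card_Diff_subset finite_subset card_mono of_nat_diff)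
  finally have alpha: "frac_indep_number J = real (card (verts J - A))" .
  have rA: "real (card A) = r_ratio H * real (card (verts J - A))"
    using ratio d by (simp add: eJ alpha)
  have le: "real (card A) \<le> r_ratio H * real (card (neighbourhood H A))"
    using expansion_ratio_le_r_ratio[OF H A] pos by (simp add: expansion_ratio_def field_simps)
  have r: "0 < r_ratio H"
    using r_ratio_pos[OF H _ d] conn by (simp add: graph_connected_def)
  have "card (verts J - A) \<le> card (neighbourhood H A)"
    using le r unfolding rA by simp
  then have NJ_eq: "neighbourhood H A = verts J - A"
    using NJ fin by (meson card_seteq finite_Diff)
  then have "J = bip_subgraph H A (neighbourhood H A)"
    using EJ AJ by (intro prod_eqI) (auto simp only: bip_subgraph_def fst_conv)
  moreover have "expansion_ratio H A = r_ratio H"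
    using rA pos by (simp add: expansion_ratio_def NJ_eq)
  ultimately show ?thesis using A by (auto simp: J_star_def)
qed


subsection \<open>Stability\<close>

lemma max_density_attained:
  assumes "simple_graph H" "nonempty_subgraphs H \<noteq> {}"
  obtains J where "J \<in> nonempty_subgraphs H" "ecount J / vcount J = max_density H"
proof -
  have "max_density H \<in> (\<lambda>J. ecount J / vcount J) ` nonempty_subgraphs H"
    unfolding max_density_def using assms by (intro Max_in) (auto simp: finite_nonempty_subgraphs)
  then show thesis using that by auto
qed

lemma density_le_max_density:
  assumes "simple_graph H" "J \<in> nonempty_subgraphs H"
  shows "ecount J / vcount J \<le> max_density H"
  unfolding max_density_def using assms by (simp add: finite_nonempty_subgraphs)

lemma nonempty_subgraph_counts_pos:
  assumes "J \<in> nonempty_subgraphs H"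
  shows "0 < ecount J" "0 < vcount J"
proof -
  have J: "simple_graph J" "edges J \<noteq> {}"
    using assms by (auto simp: nonempty_subgraphs_def subgraph_def)
  then show "0 < ecount J" by (simp add: ecount_def card_gt_0_iff simple_graph_finite_edges)
  obtain v where "v \<in> verts J" using J by (metis all_not_in_conv simple_graph_edgeE)
  then show "0 < vcount J" using J by (auto simp: vcount_def card_gt_0_iff simple_graph_finite_verts)
qed

text \<open>Strictness survives because a finite infimum is a minimum; for empty \<open>S\<close>
  the infimum is infinite and both sides hold.\<close>

lemma less_INF_finite_iff:
  fixes f :: "'b \<Rightarrow> real"
  assumes "finite S"
  shows "ereal c < (INF x\<in>S. ereal (f x)) \<longleftrightarrow> (\<forall>x\<in>S. c < f x)"
proof (cases "S = {}")
  case True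
  then show ?thesis by (simp add: top_ereal_def)
next
  case False
  with assms have "(INF x\<in>S. ereal (f x)) = Min ((\<lambda>x. ereal (f x)) ` S)"
    by (simp add: Min_Inf)
  with assms False show ?thesis by simp
qed

lemma stable_graph_iff:
  assumes "simple_graph H"
  shows "stable_graph H \<longleftrightarrow> (\<forall>J\<in>nonempty_subgraphs H. J \<notin> J_star H \<longrightarrow>
      r_ratio H * real (max_degree H) * frac_indep_number J < ecount J \<longrightarrow>
      1 / max_density H - 1 / real (max_degree H) <
        (vcount J - frac_indep_number J - ecount J / real (max_degree H)) /
        (ecount J - r_ratio H * real (max_degree H) * frac_indep_number J))"
proof -
  have "stable_graph H \<longleftrightarrow> ereal (1 / max_density H - 1 / real (max_degree H)) < eps H"
    unfolding stable_graph_def by (cases "eps H") auto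
  also have "\<dots> \<longleftrightarrow> (\<forall>J\<in>{J \<in> nonempty_subgraphs H. J \<notin> J_star H \<and>
      r_ratio H * real (max_degree H) * frac_indep_number J < ecount J}.
      1 / max_density H - 1 / real (max_degree H) <
        (vcount J - frac_indep_number J - ecount J / real (max_degree H)) /
        (ecount J - r_ratio H * real (max_degree H) * frac_indep_number J))"
    unfolding eps_def using finite_nonempty_subgraphs[OF assms] by (intro less_INF_finite_iff) simp
  finally show ?thesis by blast
qed

text \<open>After clearing denominators the \<alpha> terms cancel. The left side is 1/m - 1/d when m
  = rd/(1 + r).\<close>

lemma inverse_less_quotient_iff:
  fixes r d v e \<alpha> :: real
  assumes "0 < r" "0 < d" "0 < v" "r * d * \<alpha> < e"
  shows "1 / (r * d) < (v - \<alpha> - e / d) / (e - r * d * \<alpha>) \<longleftrightarrow> e / v < r * d / (1 + r)"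
proof -
  have "1 / (r * d) < (v - \<alpha> - e / d) / (e - r * d * \<alpha>) \<longleftrightarrow>
      e - r * d * \<alpha> < (v - \<alpha> - e / d) * (r * d)"
    using assms by (simp add: divide_simps mult.commute)
  also have "(v - \<alpha> - e / d) * (r * d) = r * d * v - r * d * \<alpha> - r * e"
    using assms by (simp add: field_simps)
  also have "e - r * d * \<alpha> < r * d * v - r * d * \<alpha> - r * e \<longleftrightarrow> e / v < r * d / (1 + r)"
    using assms by (simp add: field_simps)
  finally show ?thesis .
qed

text \<open>Here v/e stands for 1/m, with \<open>J\<close> itself of maximum density.
  Cross-multiplying leaves a difference with the positive factor \<alpha>, and the remaining factor
  compares densities.\<close>

lemma density_quotient_less_iff:
  fixes r d v e \<alpha> :: real
  assumes "0 < r" "0 < d" "0 < v" "0 < e" "0 < \<alpha>" "r * d * \<alpha> < e"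
  shows "v / e - 1 / d < (v - \<alpha> - e / d) / (e - r * d * \<alpha>) \<longleftrightarrow> e / v < r * d / (1 + r)"
proof -
  have "v / e - 1 / d = (v - e / d) / e"
    using assms by (simp add: field_simps)
  then have "v / e - 1 / d < (v - \<alpha> - e / d) / (e - r * d * \<alpha>) \<longleftrightarrow>
      (v - e / d) * (e - r * d * \<alpha>) < (v - \<alpha> - e / d) * e"
    using assms by (simp add: pos_divide_less_eq pos_less_divide_eq mult.commute)
  also have "\<dots> \<longleftrightarrow> 0 < \<alpha> * ((v - e / d) * (r * d) - e)"
    by (simp add: algebra_simps)
  also have "\<dots> \<longleftrightarrow> 0 < (v - e / d) * (r * d) - e"
    using assms by (simp add: zero_less_mult_iff)
  also have "(v - e / d) * (r * d) = r * d * v - r * e"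
    using assms by (simp add: field_simps)
  also have "0 < r * d * v - r * e - e \<longleftrightarrow> e / v < r * d / (1 + r)"
    using assms by (simp add: field_simps)
  finally show ?thesis .
qed

theorem lemma1p4:
  fixes H :: "'a graph"
  assumes "simple_graph H"
    and "graph_connected H"
    and "\<not> regular_graph H"
    and "max_degree H \<ge> 2"
  shows "stable_graph H \<longleftrightarrow>
    J_star H = {J. subgraph J H \<and> ecount J / vcount J = max_density H}"
proof -
  let ?D = "{J. subgraph J H \<and> ecount J / vcount J = max_density H}"
  define r where "r = r_ratio H"
  define d where "d = real (max_degree H)"
  define m where "m = max_density H"
  have dH: "0 < max_degree H" and d: "0 < d" using assms(4) by (simp_all add: d_def)
  have VH: "verts H \<noteq> {}" using assms(2) by (simp add: graph_connected_def)
  have r: "0 < r" unfolding r_def by (rule r_ratio_pos[OF assms(1) VH dH])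
  note star = J_star_subgraph[OF assms(1) dH, folded r_def d_def]
  obtain J0 where J0: "J0 \<in> J_star H" using J_star_nonempty[OF assms(1) VH] by auto
  have m_ge: "r * d / (1 + r) \<le> m"
    using density_le_max_density[OF assms(1) star(1)[OF J0]] star(2)[OF J0] by (simp add: m_def)
  moreover have "0 < r * d / (1 + r)" using r d by simp
  ultimately have m: "0 < m" by linarith
  \<comment> \<open>An edgeless subgraph has quotient 0, also when it has no vertices since 0/0 = 0,
    so m > 0 excludes it.\<close>
  have D_iff: "J \<in> ?D \<longleftrightarrow> J \<in> nonempty_subgraphs H \<and> ecount J / vcount J = m" for J
    using m by (auto simp: m_def nonempty_subgraphs_def ecount_def)
  note stable = stable_graph_iff[OF assms(1), folded r_def d_def m_def]
  show ?thesis
  proof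
    assume eq: "J_star H = ?D"
    have "J0 \<in> ?D" using J0 eq by blast
    then have m_eq: "m = r * d / (1 + r)" using star(2)[OF J0] by (simp add: m_def)
    then have "1 / m - 1 / d = 1 / (r * d)"
      using r d unfolding m_eq by (simp add: field_simps)
    moreover have "1 / (r * d) < (vcount J - frac_indep_number J - ecount J / d) /
        (ecount J - r * d * frac_indep_number J)"
      if J: "J \<in> nonempty_subgraphs H" "J \<notin> J_star H" "r * d * frac_indep_number J < ecount J" for J
    proof -
      \<comment> \<open>As \<open>J_star H\<close> is assumed to contain every subgraph of density
        m, a \<open>J\<close> outside it is strictly sparser.\<close>
      have "ecount J / vcount J < m"
        using density_le_max_density[OF assms(1) J(1), folded m_def] J(1,2)
        unfolding eq D_iff by simp
      then show ?thesis
        using inverse_less_quotient_iff[OF r d nonempty_subgraph_counts_pos(2)[OF J(1)] J(3)] m_eq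
        by simp
    qed
    ultimately show "stable_graph H" unfolding stable by simp
  next
    assume st: "stable_graph H"
    have D_star: "J \<in> J_star H" if "J \<in> ?D" for J
    proof (rule ccontr)
      assume notin: "J \<notin> J_star H"
      have J: "J \<in> nonempty_subgraphs H" and Jm: "ecount J / vcount J = m"
        using that D_iff by auto
      note pos = nonempty_subgraph_counts_pos[OF J]
      have JH: "subgraph J H" using that by simp
      have alpha: "0 < frac_indep_number J"
        using J by (intro frac_indep_number_pos) (auto simp: nonempty_subgraphs_def subgraph_def)
      show False
      proof (cases "r * d * frac_indep_number J < ecount J")
        case True
        \<comment> \<open>Stability would push the density of \<open>J\<close> below rd/(1 + r)
          \<le> m, although that density is m.\<close>
        have "1 / m = vcount J / ecount J" unfolding Jm[symmetric] by simp
        then have "ecount J / vcount J < r * d / (1 + r)"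
          using st J notin True density_quotient_less_iff[OF r d pos(2,1) alpha True]
          unfolding stable by auto
        then show False using m_ge Jm by simp
      next
        case False
        \<comment> \<open>Such a \<open>J\<close> is not tested by \<open>eps\<close>. Instead the
          bounds close up: 0 \<le> rdv - rd\<alpha> - re \<le> e - rd\<alpha> \<le> 0, so both
          tightness conditions hold.\<close>
        have cover: "0 \<le> vcount J - frac_indep_number J - ecount J / d"
          unfolding d_def by (rule ecount_le_frac_cover[OF assms(1) JH dH])
        then have "0 \<le> r * d * (vcount J - frac_indep_number J - ecount J / d)"
          using r d by simp
        moreover have eq: "r * d * (vcount J - frac_indep_number J - ecount J / d) =
            r * d * vcount J - r * d * frac_indep_number J - r * ecount J"
          using d by (simp add: field_simps)
        moreover have "r * d * vcount J \<le> ecount J + r * ecount J"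
          using m_ge r pos unfolding Jm[symmetric] by (simp add: field_simps)
        ultimately have "ecount J = r * d * frac_indep_number J"
          and "r * d * (vcount J - frac_indep_number J - ecount J / d) = 0"
          using False by linarith+
        then have "J \<in> J_star H"
          using tight_subgraph_in_J_star[OF assms(1-3) dH J, folded r_def d_def] r d by simp
        with notin show False by simp
      qed
    qed
    \<comment> \<open>A densest subgraph now lies in \<open>J_star H\<close>, so m is the common
      density of that family, which gives the reverse inclusion.\<close>
    have "nonempty_subgraphs H \<noteq> {}" using star(1)[OF J0] by auto
    then obtain J1 where "J1 \<in> ?D"
      using max_density_attained[OF assms(1)] D_iff unfolding m_def by metis
    then have "J1 \<in> J_star H" "ecount J1 / vcount J1 = m" using D_star D_iff by blast+
    then have "m = r * d / (1 + r)" using star(2) by simp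
    then have "J_star H \<subseteq> ?D" using star D_iff by blast
    then show "J_star H = ?D" using D_star by blast
  qed
qed

end
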